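(* Let $E_1,E_2$ be Banach spaces, $E=E_1\times E_2$, let $\phi_1:E_1\to\mathbb R$ and $\phi_2:E_2\to\mathbb R$ be locally Lipschitz functions, and define $\phi:E\to\mathbb R$ by $\phi(x_1,x_2)=\phi_1(x_1)+\phi_2(x_2)$. Then $\phi$ is locally Lipschitz and for every $(x_1,x_2)\in E$, $$\partial\phi(x_1,x_2)\subset\partial\phi_1(x_1)\times\partial\phi_2(x_2).$$ Moreover, $\partial_k\phi(x_1,x_2)=\partial\phi_k(x_k)$ for $k=1,2$. If $\phi_1$ is regular at $x_1$ or $\phi_2$ is regular at $x_2$, then equality holds, i.e. $\partial\phi(x_1,x_2)=\partial\phi_1(x_1)\times\partial\phi_2(x_2)$.
   Context: For a locally Lipschitz function $\psi:X\to\mathbb R$ on a Banach space $X$, the Clarke generalized directional derivative is $\psi^\circ(x;v)=\limsup_{w\to x,\,h\downarrow0}\frac{\psi(w+hv)-\psi(w)}{h}$ and the Clarke generalized gradient is $\partial\psi(x)=\{\xi\in X^*:\langle\xi,v\rangle\le\psi^\circ(x;v)\ \forall v\in X\}$. The function $\psi$ is called regular at $x$ if for all $v\in X$ the one-sided directional derivative $\psi'(x;v)=\lim_{h\downarrow0}\frac{\psi(x+hv)-\psi(x)}{h}$ exists and equals $\psi^\circ(x;v)$. The dual of $E=E_1\times E_2$ is identified with $E_1^*\times E_2^*$ via $\langle(z_1,z_2),(v_1,v_2)\rangle=\langle z_1,v_1\rangle+\langle z_2,v_2\rangle$. $\partial_1\phi(x_1,x_2)$ denotes the (partial) Clarke generalized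 gradient of $\phi(\cdot,x_2)$ at $x_1$, and $\partial_2\phi(x_1,x_2)$ that of $\phi(x_1,\cdot)$ at $x_2$. *)

theory Defs
  imports "HOL-Analysis.Analysis"
begin

definition locally_lipschitz :: "('a::metric_space \<Rightarrow> 'b::metric_space) \<Rightarrow> bool" where
  "locally_lipschitz f \<longleftrightarrow> (\<forall>x. \<exists>u>0. \<exists>L. L-lipschitz_on (cball x u) f)"

(* The library notion local_lipschitz concerns families of functions; the two agree on
   constant families. *)
lemma locally_lipschitz_iff_local_lipschitz:
  "locally_lipschitz f \<longleftrightarrow> local_lipschitz {0::real} UNIV (\<lambda>_. f)"
proof -
  have "(u > 0 \<and> (0 \<le> u \<longrightarrow> P)) \<longleftrightarrow> u > 0 \<and> P" for u :: real and P
    by auto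
  then show ?thesis
    by (simp add: locally_lipschitz_def local_lipschitz_def)
qed

(* The limsup is taken in the extended reals, since for an arbitrary function it may be infinite.
   The base point w ranges over full neighbourhoods of x, including x itself. *)
definition clarke_dderiv :: "('a::real_normed_vector \<Rightarrow> real) \<Rightarrow> 'a \<Rightarrow> 'a \<Rightarrow> ereal" where
  "clarke_dderiv \<psi> x v =
     Limsup (nhds x \<times>\<^sub>F at_right 0) (\<lambda>(w, h). ereal ((\<psi> (w + h *\<^sub>R v) - \<psi> w) / h))"

definition clarke_gradient :: "('a::real_normed_vector \<Rightarrow> real) \<Rightarrow> 'a \<Rightarrow> ('a \<Rightarrow>\<^sub>L real) set" where
  "clarke_gradient \<psi> x = {\<xi>. \<forall>v. ereal (blinfun_apply \<xi> v) \<le> clarke_dderiv \<psi> x v}"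

definition clarke_gradient1 ::
  "('a::real_normed_vector \<times> 'b::real_normed_vector \<Rightarrow> real) \<Rightarrow> 'a \<Rightarrow> 'b \<Rightarrow> ('a \<Rightarrow>\<^sub>L real) set" where
  "clarke_gradient1 \<phi> x1 x2 = clarke_gradient (\<lambda>y. \<phi> (y, x2)) x1"

definition clarke_gradient2 ::
  "('a::real_normed_vector \<times> 'b::real_normed_vector \<Rightarrow> real) \<Rightarrow> 'a \<Rightarrow> 'b \<Rightarrow> ('b \<Rightarrow>\<^sub>L real) set" where
  "clarke_gradient2 \<phi> x1 x2 = clarke_gradient (\<lambda>y. \<phi> (x1, y)) x2"

definition clarke_regular :: "('a::real_normed_vector \<Rightarrow> real) \<Rightarrow> 'a \<Rightarrow> bool" where
  "clarke_regular \<psi> x \<longleftrightarrow>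
     (\<forall>v. \<exists>d. ((\<lambda>h. (\<psi> (x + h *\<^sub>R v) - \<psi> x) / h) \<longlongrightarrow> d) (at_right 0) \<and>
              clarke_dderiv \<psi> x v = ereal d)"

(* The identification of the product of the duals with the dual of the product.
   The product type carries the Euclidean product norm; any equivalent norm gives the same dual
   space and the same Clarke notions. *)
definition dual_prod ::
  "('a::real_normed_vector \<Rightarrow>\<^sub>L real) \<times> ('b::real_normed_vector \<Rightarrow>\<^sub>L real) \<Rightarrow> ('a \<times> 'b) \<Rightarrow>\<^sub>L real" where
  "dual_prod = (\<lambda>(z1, z2). Blinfun (\<lambda>(v1, v2). blinfun_apply z1 v1 + blinfun_apply z2 v2))"

lemma dual_prod_apply [simp]:
  "blinfun_apply (dual_prod (z1, z2)) (v1, v2) = blinfun_apply z1 v1 + blinfun_apply z2 v2"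
proof -
  have "bounded_linear (\<lambda>p. blinfun_apply z1 (fst p) + blinfun_apply z2 (snd p))"
    by (intro bounded_linear_intros)
  then have "bounded_linear (\<lambda>(v1, v2). blinfun_apply z1 v1 + blinfun_apply z2 v2)"
    by (simp add: case_prod_beta')
  then show ?thesis
    by (simp add: dual_prod_def bounded_linear_Blinfun_apply)
qed

lemma bij_dual_prod:
  "bij (dual_prod :: ('a::real_normed_vector \<Rightarrow>\<^sub>L real) \<times> ('b::real_normed_vector \<Rightarrow>\<^sub>L real) \<Rightarrow> _)"
proof (rule bijI)
  show "inj (dual_prod :: ('a \<Rightarrow>\<^sub>L real) \<times> ('b \<Rightarrow>\<^sub>L real) \<Rightarrow> _)"
  proof (rule injI)
    fix z y :: "('a \<Rightarrow>\<^sub>L real) \<times> ('b \<Rightarrow>\<^sub>L real)"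
    assume "dual_prod z = dual_prod y"
    moreover obtain z1 z2 y1 y2 where zy: "z = (z1, z2)" "y = (y1, y2)"
      by (cases z; cases y) blast
    ultimately have eq: "dual_prod (z1, z2) = dual_prod (y1, y2)"
      by simp
    have "z1 = y1"
    proof (rule blinfun_eqI)
      show "blinfun_apply z1 v = blinfun_apply y1 v" for v
        using arg_cong[OF eq, of "\<lambda>z. blinfun_apply z (v, 0)"] by simp
    qed
    moreover have "z2 = y2"
    proof (rule blinfun_eqI)
      show "blinfun_apply z2 v = blinfun_apply y2 v" for v
        using arg_cong[OF eq, of "\<lambda>z. blinfun_apply z (0, v)"] by simp
    qed
    ultimately show "z = y"
      by (simp only: zy)
  qed
  show "surj (dual_prod :: ('a \<Rightarrow>\<^sub>L real) \<times> ('b \<Rightarrow>\<^sub>L real) \<Rightarrow> _)"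
  proof (rule surjI[where f = "\<lambda>z. (Blinfun (\<lambda>v. blinfun_apply z (v, 0)), Blinfun (\<lambda>v. blinfun_apply z (0, v)))"])
    fix z :: "('a \<times> 'b) \<Rightarrow>\<^sub>L real"
    have 1: "bounded_linear (\<lambda>v::'a. blinfun_apply z (v, 0))"
      by (intro bounded_linear_intros bounded_linear_Pair)
    have 2: "bounded_linear (\<lambda>v::'b. blinfun_apply z (0, v))"
      by (intro bounded_linear_intros bounded_linear_Pair)
    have "blinfun_apply z (v1, 0) + blinfun_apply z (0, v2) = blinfun_apply z (v1, v2)" for v1 v2
      by (simp flip: blinfun.add_right)
    then show "dual_prod (Blinfun (\<lambda>v. blinfun_apply z (v, 0)), Blinfun (\<lambda>v. blinfun_apply z (0, v))) = z"
      by (intro blinfun_eqI) (auto simp: bounded_linear_Blinfun_apply[OF 1] bounded_linear_Blinfun_apply[OF 2])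
  qed
qed

lemma clarke_dderiv_finite:
  assumes "locally_lipschitz \<psi>"
  shows "\<bar>clarke_dderiv \<psi> x v\<bar> \<noteq> \<infinity>"
proof -
  let ?F = "nhds x \<times>\<^sub>F at_right (0::real)"
  let ?q = "\<lambda>(w, h). ereal ((\<psi> (w + h *\<^sub>R v) - \<psi> w) / h)"
  obtain u L where u: "u > 0" and L: "L-lipschitz_on (cball x u) \<psi>"
    using assms unfolding locally_lipschitz_def by blast
  have fst: "filterlim fst (nhds x) ?F"
    by (rule filterlim_fst)
  have snd: "filterlim snd (at_right 0) ?F"
    by (rule filterlim_snd)
  have snd0: "(snd \<longlongrightarrow> 0) ?F"
    using snd by (simp add: filterlim_at)
  have "((\<lambda>p. fst p + snd p *\<^sub>R v) \<longlongrightarrow> x + 0 *\<^sub>R v) ?F"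
    by (intro tendsto_intros fst snd0)
  then have A: "eventually (\<lambda>p. fst p + snd p *\<^sub>R v \<in> ball x u) ?F"
    using u by (intro topological_tendstoD) auto
  have B: "eventually (\<lambda>p. fst p \<in> ball x u) ?F"
    using u by (intro topological_tendstoD[OF fst]) auto
  have C: "eventually (\<lambda>p. snd p > 0) ?F"
    using snd by (auto simp: filterlim_at elim: eventually_mono)
  have D: "eventually (\<lambda>p. \<bar>(\<psi> (fst p + snd p *\<^sub>R v) - \<psi> (fst p)) / snd p\<bar> \<le> L * norm v) ?F"
    using A B C
  proof eventually_elim
    case (elim p)
    have "dist (\<psi> (fst p + snd p *\<^sub>R v)) (\<psi> (fst p)) \<le> L * dist (fst p + snd p *\<^sub>R v) (fst p)"
      using elim by (intro lipschitz_onD[OF L]) auto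
    then show ?case
      using elim by (simp add: dist_norm abs_divide divide_le_eq mult_ac)
  qed
  have le: "eventually (\<lambda>p. ?q p \<le> ereal (L * norm v)) ?F"
    using D by (rule eventually_mono) (unfold case_prod_beta ereal_less_eq(3), rule abs_le_D1)
  have ge: "eventually (\<lambda>p. ereal (- (L * norm v)) \<le> ?q p) ?F"
    using D by (rule eventually_mono)
      (unfold case_prod_beta ereal_less_eq(3), drule abs_le_D2, rule iffD1[OF minus_le_iff])
  have ub: "Limsup ?F ?q \<le> ereal (L * norm v)"
    using le by (rule Limsup_bounded)
  have "?F \<noteq> bot"
    by (simp add: prod_filter_eq_bot)
  then have "ereal (- (L * norm v)) \<le> Limsup ?F ?q"
    using Liminf_bounded[OF ge] Liminf_le_Limsup order_trans by blast
  with ub show ?thesis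
    unfolding clarke_dderiv_def by (cases "Limsup ?F ?q") auto
qed

end

theory Submission
  imports Defs
begin

text \<open>
  The difference quotient of a separated sum splits: at base point \<open>(w1, w2)\<close> in direction
  \<open>(v1, v2)\<close> it is the quotient of the first summand at \<open>w1\<close> plus that of the second at \<open>w2\<close>,
  with the same step \<open>h\<close>.

  In the directions \<open>(v1, 0)\<close> and \<open>(0, v2)\<close> only one of the two quotients survives. Hence a Clarke
  subgradient of the sum, restricted to the two factors, gives a Clarke subgradient of each summand
  (lemmas \<open>clarke_dderiv_separated_fst\<close> and \<open>clarke_dderiv_separated_snd\<close>). This is the inclusion.
  The partial gradients are immediate: freezing one variable leaves a summand plus a constant, and
  constants cancel in difference quotients.

  The reverse inclusion needs the directional derivative of the sum to be at least the sum of the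
  directional derivatives, while a limsup is in general only subadditive. If one summand is
  regular, its base point may be held fixed: along that restricted approach its quotient converges,
  and to its full generalized derivative. Adding a convergent term commutes with a limsup, and
  restricting the approach can only lower the limsup, so the missing inequality follows
  (lemma \<open>clarke_dderiv_separated_superadd_fst\<close> and its mirror image).
\<close>

section \<open>Upper limits along filters\<close>

lemma Limsup_filterlim_le:
  fixes q :: "'b \<Rightarrow> 'c::complete_linorder"
  assumes "filterlim g G F"
  shows "Limsup F (\<lambda>x. q (g x)) \<le> Limsup G q"
proof -
  have "Limsup F (\<lambda>x. q (g x)) \<le> Limsup (filtermap g F) q"
    by (rule Limsup_filtermap_ge)
  also have "\<dots> \<le> Limsup G q"
    unfolding Limsup_def
    by (rule INF_superset_mono) (use assms in \<open>auto simp: filterlim_def le_filter_def\<close>)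
  finally show ?thesis .
qed

text \<open>
  Up to an arbitrarily small \<open>e\<close>, the convergent summand is eventually bounded below by its limit,
  and a constant can be moved through the limsup.
\<close>
lemma tendsto_add_Limsup_le:
  fixes f g :: "'a \<Rightarrow> real"
  assumes F: "F \<noteq> bot" and f: "(f \<longlongrightarrow> d) F"
  shows "ereal d + Limsup F (\<lambda>x. ereal (g x)) \<le> Limsup F (\<lambda>x. ereal (f x + g x))"
proof (rule ereal_le_epsilon2)
  fix e :: real
  assume "e > 0"
  then have "eventually (\<lambda>x. d - e < f x) F"
    using f by (intro order_tendstoD(1)) auto
  then have "Limsup F (\<lambda>x. ereal (d - e) + ereal (g x)) \<le> Limsup F (\<lambda>x. ereal (f x + g x))"
    by (intro Limsup_mono) (auto elim: eventually_mono)
  then have "ereal (d - e) + Limsup F (\<lambda>x. ereal (g x)) \<le> Limsup F (\<lambda>x. ereal (f x + g x))"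
    by (subst (asm) Limsup_add_ereal_left) (use F in auto)
  then have "ereal (d - e) + Limsup F (\<lambda>x. ereal (g x)) + ereal e
      \<le> Limsup F (\<lambda>x. ereal (f x + g x)) + ereal e"
    by (rule add_right_mono)
  moreover have "ereal (d - e) + y + ereal e = ereal d + y" for y
    by (cases y) auto
  ultimately show "ereal d + Limsup F (\<lambda>x. ereal (g x)) \<le> Limsup F (\<lambda>x. ereal (f x + g x)) + ereal e"
    by simp
qed

section \<open>Separated sums\<close>

lemma locally_lipschitz_separated_sum:
  fixes f :: "'a::metric_space \<Rightarrow> 'c::real_normed_vector" and g :: "'b::metric_space \<Rightarrow> 'c"
  assumes "locally_lipschitz f" and "locally_lipschitz g"
  shows "locally_lipschitz (\<lambda>p. f (fst p) + g (snd p))"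
  unfolding locally_lipschitz_def
proof
  fix x :: "'a \<times> 'b"
  obtain u K where u: "u > 0" and K: "K-lipschitz_on (cball (fst x) u) f"
    using assms(1) unfolding locally_lipschitz_def by blast
  obtain v L where v: "v > 0" and L: "L-lipschitz_on (cball (snd x) v) g"
    using assms(2) unfolding locally_lipschitz_def by blast
  let ?B = "cball x (min u v)"
  have "1-lipschitz_on ?B fst" "1-lipschitz_on ?B snd"
    by (simp_all add: lipschitz_on_def dist_fst_le dist_snd_le del: split_paired_All)
  moreover have "fst ` ?B \<subseteq> cball (fst x) u" "snd ` ?B \<subseteq> cball (snd x) v"
    by (auto intro: order_trans[OF dist_fst_le] order_trans[OF dist_snd_le]
        simp del: fst_conv snd_conv)
  ultimately have "(K * 1 + L * 1)-lipschitz_on ?B (\<lambda>p. f (fst p) + g (snd p))"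
    by (intro lipschitz_on_add lipschitz_on_compose2)
      (auto intro: lipschitz_on_subset[OF K] lipschitz_on_subset[OF L])
  then show "\<exists>r>0. \<exists>M. M-lipschitz_on (cball x r) (\<lambda>p. f (fst p) + g (snd p))"
    using u v by (intro exI[of _ "min u v"]) auto
qed

text \<open>
  With second direction component 0 the second quotient vanishes, and the remaining one sees only
  the first coordinate of the base point, which tends to \<open>x1\<close>.
\<close>
lemma clarke_dderiv_separated_fst:
  "clarke_dderiv (\<lambda>p. f (fst p) + g (snd p)) (x1, x2) (v, 0) \<le> clarke_dderiv f x1 v"
proof -
  have "filterlim (\<lambda>p. (fst (fst p), snd p)) (nhds x1 \<times>\<^sub>F at_right 0)
      (nhds (x1, x2) \<times>\<^sub>F at_right (0::real))"
    unfolding nhds_prod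
    by (intro filterlim_Pair filterlim_compose[OF filterlim_fst filterlim_fst] filterlim_snd)
  from Limsup_filterlim_le[OF this, of "\<lambda>(w, h). ereal ((f (w + h *\<^sub>R v) - f w) / h)"]
  show ?thesis
    by (simp add: clarke_dderiv_def case_prod_beta')
qed

lemma clarke_dderiv_separated_snd:
  "clarke_dderiv (\<lambda>p. f (fst p) + g (snd p)) (x1, x2) (0, v) \<le> clarke_dderiv g x2 v"
proof -
  have "filterlim (\<lambda>p. (snd (fst p), snd p)) (nhds x2 \<times>\<^sub>F at_right 0)
      (nhds (x1, x2) \<times>\<^sub>F at_right (0::real))"
    unfolding nhds_prod
    by (intro filterlim_Pair filterlim_compose[OF filterlim_snd filterlim_fst] filterlim_snd)
  from Limsup_filterlim_le[OF this, of "\<lambda>(w, h). ereal ((g (w + h *\<^sub>R v) - g w) / h)"]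
  show ?thesis
    by (simp add: clarke_dderiv_def case_prod_beta')
qed

text \<open>
  Freezing the first base coordinate at \<open>x1\<close> turns the first quotient into the ordinary
  one-sided one, whose limit regularity identifies with the generalized derivative.
\<close>
lemma clarke_dderiv_separated_superadd_fst:
  assumes "clarke_regular f x1"
  shows "clarke_dderiv f x1 v1 + clarke_dderiv g x2 v2
      \<le> clarke_dderiv (\<lambda>p. f (fst p) + g (snd p)) (x1, x2) (v1, v2)"
proof -
  let ?F = "nhds x2 \<times>\<^sub>F at_right (0::real)"
  let ?qf = "\<lambda>p. (f (x1 + snd p *\<^sub>R v1) - f x1) / snd p"
  let ?qg = "\<lambda>p. (g (fst p + snd p *\<^sub>R v2) - g (fst p)) / snd p"
  obtain d where d: "((\<lambda>h. (f (x1 + h *\<^sub>R v1) - f x1) / h) \<longlongrightarrow> d) (at_right 0)"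
    and eq: "clarke_dderiv f x1 v1 = ereal d"
    using assms unfolding clarke_regular_def by blast
  have nb: "?F \<noteq> bot"
    by (simp add: prod_filter_eq_bot)
  have "(?qf \<longlongrightarrow> d) ?F"
    by (rule filterlim_compose[OF d filterlim_snd])
  then have "clarke_dderiv f x1 v1 + clarke_dderiv g x2 v2 \<le> Limsup ?F (\<lambda>p. ereal (?qf p + ?qg p))"
    using tendsto_add_Limsup_le[OF nb, of ?qf d ?qg]
    by (simp add: eq clarke_dderiv_def[of g] case_prod_beta')
  also have "\<dots> \<le> clarke_dderiv (\<lambda>p. f (fst p) + g (snd p)) (x1, x2) (v1, v2)"
  proof -
    have "filterlim (\<lambda>p. ((x1, fst p), snd p)) (nhds (x1, x2) \<times>\<^sub>F at_right 0) ?F"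
      unfolding nhds_prod by (intro filterlim_Pair filterlim_fst filterlim_snd tendsto_const)
    from Limsup_filterlim_le[OF this, of "\<lambda>(w, h). ereal ((f (fst (w + h *\<^sub>R (v1, v2)))
        + g (snd (w + h *\<^sub>R (v1, v2))) - (f (fst w) + g (snd w))) / h)"]
    show ?thesis
      by (simp add: clarke_dderiv_def case_prod_beta' diff_divide_distrib add_divide_distrib
          algebra_simps)
  qed
  finally show ?thesis .
qed

text \<open>
  Exchanging the factors maps approaches of \<open>(x2, x1)\<close> to approaches of \<open>(x1, x2)\<close>; this carries the
  superadditivity from a regular first summand to a regular second one.
\<close>
lemma clarke_dderiv_separated_swap:
  "clarke_dderiv (\<lambda>p. g (fst p) + f (snd p)) (x2, x1) (v2, v1)
    \<le> clarke_dderiv (\<lambda>p. f (fst p) + g (snd p)) (x1, x2) (v1, v2)"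
proof -
  have "filterlim (\<lambda>p. ((snd (fst p), fst (fst p)), snd p)) (nhds (x1, x2) \<times>\<^sub>F at_right 0)
      (nhds (x2, x1) \<times>\<^sub>F at_right (0::real))"
    unfolding nhds_prod
    by (intro filterlim_Pair filterlim_compose[OF filterlim_fst filterlim_fst]
        filterlim_compose[OF filterlim_snd filterlim_fst] filterlim_snd)
  from Limsup_filterlim_le[OF this, of "\<lambda>(w, h). ereal ((f (fst (w + h *\<^sub>R (v1, v2)))
      + g (snd (w + h *\<^sub>R (v1, v2))) - (f (fst w) + g (snd w))) / h)"]
  show ?thesis
    by (simp add: clarke_dderiv_def case_prod_beta' add.commute)
qed

lemma clarke_dderiv_separated_superadd_snd:
  assumes "clarke_regular g x2"
  shows "clarke_dderiv f x1 v1 + clarke_dderiv g x2 v2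
      \<le> clarke_dderiv (\<lambda>p. f (fst p) + g (snd p)) (x1, x2) (v1, v2)"
proof -
  have "clarke_dderiv g x2 v2 + clarke_dderiv f x1 v1
      \<le> clarke_dderiv (\<lambda>p. g (fst p) + f (snd p)) (x2, x1) (v2, v1)"
    using assms by (rule clarke_dderiv_separated_superadd_fst)
  also have "\<dots> \<le> clarke_dderiv (\<lambda>p. f (fst p) + g (snd p)) (x1, x2) (v1, v2)"
    by (rule clarke_dderiv_separated_swap)
  finally show ?thesis
    by (simp add: add.commute)
qed

section \<open>Clarke gradients of separated sums\<close>

lemma clarke_gradient_add_const:
  "clarke_gradient (\<lambda>y. f y + c) x = clarke_gradient f x"
  by (simp add: clarke_gradient_def clarke_dderiv_def)

lemma clarke_gradient_separated_subset:
  "clarke_gradient (\<lambda>p. f (fst p) + g (snd p)) (x1, x2)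
    \<subseteq> dual_prod ` (clarke_gradient f x1 \<times> clarke_gradient g x2)"
proof
  fix \<xi>
  assume \<xi>: "\<xi> \<in> clarke_gradient (\<lambda>p. f (fst p) + g (snd p)) (x1, x2)"
  obtain z1 z2 where z: "\<xi> = dual_prod (z1, z2)"
    using bij_dual_prod by (metis bij_pointE surj_pair)
  have le: "ereal (z1 v1 + z2 v2) \<le> clarke_dderiv (\<lambda>p. f (fst p) + g (snd p)) (x1, x2) (v1, v2)"
    for v1 v2
    using \<xi> by (simp add: z clarke_gradient_def flip: dual_prod_apply)
  have "z1 \<in> clarke_gradient f x1"
    using order_trans[OF le[of _ 0] clarke_dderiv_separated_fst] by (simp add: clarke_gradient_def)
  moreover have "z2 \<in> clarke_gradient g x2"
    using order_trans[OF le[of 0] clarke_dderiv_separated_snd] by (simp add: clarke_gradient_def)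
  ultimately show "\<xi> \<in> dual_prod ` (clarke_gradient f x1 \<times> clarke_gradient g x2)"
    using z by blast
qed

lemma clarke_gradient_separated_superset:
  assumes "clarke_regular f x1 \<or> clarke_regular g x2"
  shows "dual_prod ` (clarke_gradient f x1 \<times> clarke_gradient g x2)
    \<subseteq> clarke_gradient (\<lambda>p. f (fst p) + g (snd p)) (x1, x2)"
proof clarify
  fix z1 z2
  assume z1: "z1 \<in> clarke_gradient f x1" and z2: "z2 \<in> clarke_gradient g x2"
  have "ereal (z1 v1 + z2 v2) \<le> clarke_dderiv (\<lambda>p. f (fst p) + g (snd p)) (x1, x2) (v1, v2)"
    for v1 v2
  proof -
    have "ereal (z1 v1) + ereal (z2 v2) \<le> clarke_dderiv f x1 v1 + clarke_dderiv g x2 v2"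
      using z1 z2 by (intro add_mono) (auto simp: clarke_gradient_def)
    also have "\<dots> \<le> clarke_dderiv (\<lambda>p. f (fst p) + g (snd p)) (x1, x2) (v1, v2)"
      using assms clarke_dderiv_separated_superadd_fst clarke_dderiv_separated_superadd_snd by blast
    finally show ?thesis
      by simp
  qed
  then show "dual_prod (z1, z2) \<in> clarke_gradient (\<lambda>p. f (fst p) + g (snd p)) (x1, x2)"
    by (simp add: clarke_gradient_def)
qed

theorem proposition2:
  fixes \<phi>1 :: "'a::banach \<Rightarrow> real"
    and \<phi>2 :: "'b::banach \<Rightarrow> real"
    and \<phi> :: "'a \<times> 'b \<Rightarrow> real"
  assumes "locally_lipschitz \<phi>1"
    and "locally_lipschitz \<phi>2"
    and "\<And>x1 x2. \<phi> (x1, x2) = \<phi>1 x1 + \<phi>2 x2"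
  shows "locally_lipschitz \<phi> \<and>
    (\<forall>x1 x2.
       clarke_gradient \<phi> (x1, x2) \<subseteq> dual_prod ` (clarke_gradient \<phi>1 x1 \<times> clarke_gradient \<phi>2 x2) \<and>
       clarke_gradient1 \<phi> x1 x2 = clarke_gradient \<phi>1 x1 \<and>
       clarke_gradient2 \<phi> x1 x2 = clarke_gradient \<phi>2 x2 \<and>
       (clarke_regular \<phi>1 x1 \<or> clarke_regular \<phi>2 x2 \<longrightarrow>
          clarke_gradient \<phi> (x1, x2) = dual_prod ` (clarke_gradient \<phi>1 x1 \<times> clarke_gradient \<phi>2 x2)))"
proof -
  have \<phi>: "\<phi> = (\<lambda>p. \<phi>1 (fst p) + \<phi>2 (snd p))"
    using assms(3) by auto
  have "locally_lipschitz \<phi>"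
    unfolding \<phi> using assms(1,2) by (rule locally_lipschitz_separated_sum)
  moreover have "clarke_gradient1 \<phi> x1 x2 = clarke_gradient \<phi>1 x1" for x1 x2
    by (simp add: clarke_gradient1_def \<phi> clarke_gradient_add_const)
  moreover have "clarke_gradient2 \<phi> x1 x2 = clarke_gradient \<phi>2 x2" for x1 x2
    using clarke_gradient_add_const[of \<phi>2 "\<phi>1 x1" x2]
    by (simp add: clarke_gradient2_def \<phi> add.commute)
  moreover have "clarke_gradient \<phi> (x1, x2)
      \<subseteq> dual_prod ` (clarke_gradient \<phi>1 x1 \<times> clarke_gradient \<phi>2 x2)" for x1 x2
    unfolding \<phi> by (rule clarke_gradient_separated_subset)
  moreover have "dual_prod ` (clarke_gradient \<phi>1 x1 \<times> clarke_gradient \<phi>2 x2)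
      \<subseteq> clarke_gradient \<phi> (x1, x2)" if "clarke_regular \<phi>1 x1 \<or> clarke_regular \<phi>2 x2" for x1 x2
    unfolding \<phi> using that by (rule clarke_gradient_separated_superset)
  ultimately show ?thesis
    by (simp add: subset_antisym)
qed

end
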